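(* Suppose that $A$ is any $d\times n$ matrix over the finite field $k=\mathbb{F}_{d+1}$, where $d+1$ is prime. Further, suppose that there is no vector $X\in k^n$ such that neither $X$ nor $AX$ has any $0$ entries. Then either a row of $A$ is identically $0$, or $$A=\begin{pmatrix}1&b_1&0&\cdots&0\\1&b_2&0&\cdots&0\\\vdots&\vdots&\vdots&&\vdots\\1&b_d&0&\cdots&0\end{pmatrix}$$ up to scaling of the rows and permutation of the columns, where $\{b_1,\dots,b_d\}$ is the multiplicative group $k^{*}$ of nonzero elements of $k$.
   Formalization: The case d = 1 (k = F_2) is excluded by assuming d ≥ 2, since the claim fails there: for A = (1 1 1 1) over F_2 the only X with no 0 entries gives AX = 0, yet A has no zero row and is not of the displayed form. *)

theory Defs
  imports "Jordan_Normal_Form.Matrix" "HOL-Combinatorics.Permutations"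
    "HOL-Computational_Algebra.Primes"
begin

text \<open>Row and column indices start at 0, as usual for \<^typ>\<open>'a mat\<close>.\<close>

definition nowhere_zero_vec :: "'a::zero vec \<Rightarrow> bool" where
  "nowhere_zero_vec v \<longleftrightarrow> (\<forall>i < dim_vec v. v $ i \<noteq> 0)"

text \<open>The \<open>d \<times> n\<close> matrix with rows \<open>(1, b i, 0, \<dots>, 0)\<close>. It has the intended shape
  only for \<open>n \<ge> 2\<close>; for smaller \<open>n\<close> the columns are cut off.\<close>

definition one_b_mat :: "nat \<Rightarrow> nat \<Rightarrow> (nat \<Rightarrow> 'a) \<Rightarrow> 'a::zero_neq_one mat" where
  "one_b_mat d n b = mat d n (\<lambda>(i, j). if j = 0 then 1 else if j = 1 then b i else 0)"

definition eq_upto_row_scaling_col_perm :: "'a::semiring_0 mat \<Rightarrow> 'a mat \<Rightarrow> bool" where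
  "eq_upto_row_scaling_col_perm A B \<longleftrightarrow>
     (\<exists>c \<sigma>. (\<forall>i < dim_row B. c i \<noteq> 0) \<and> \<sigma> permutes {..<dim_col B} \<and>
        A = mat (dim_row B) (dim_col B) (\<lambda>(i, j). c i * B $$ (i, \<sigma> j)))"

end

theory Submission
  imports Defs "HOL-Computational_Algebra.Polynomial" "HOL-Number_Theory.Residues"
begin

hide_const (open) up_ring.coeff up_ring.monom

text \<open>Let \<open>F x\<close> be the product of the \<open>d\<close> linear forms given by the rows of \<open>A\<close>, and \<open>c j\<close> the
  product of the entries of column \<open>j\<close>. As a function of a single coordinate \<open>x j\<close>, \<open>F\<close> is a
  polynomial of degree at most \<open>d = |k| - 1\<close>, so its sum over all values of \<open>x j\<close> is minus its
  coefficient of degree \<open>d\<close>, which is \<open>- c j\<close>. As \<open>F\<close> vanishes on vectors without zero entries,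
  replacing entries by \<open>0\<close> one at a time shows that \<open>F x\<close> is the sum of \<open>- c j\<close> over the \<open>j\<close>
  with \<open>x j = 0\<close>; since \<open>F 0 = 0\<close>, it is also the sum of \<open>c j\<close> over the support of \<open>x\<close>.

  If \<open>c j = 0\<close>, then \<open>F\<close> does not depend on \<open>x j\<close>. A nonzero entry in column \<open>j\<close> would therefore
  force \<open>F = 0\<close>, but \<open>d < |k|\<close> hyperplanes cannot cover \<open>k\<^sup>n\<close>. If \<open>c j\<close> and \<open>c l\<close> are both
  nonzero, then \<open>F\<close> has a zero with support \<open>{j, l}\<close>, so \<open>c j + c l = 0\<close>; in odd characteristic
  this cannot hold for all pairs from a set of three columns.\<close>

section \<open>Power sums over a finite field\<close>

lemma of_nat_card_UNIV_eq_0: "of_nat (card (UNIV :: 'k set)) = (0 :: 'k::{ring_1,finite})"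
  using CHAR_dvd_CARD[where 'a = 'k] by (simp only: of_nat_eq_0_iff_char_dvd)

lemma bij_betw_mult_nonzero:
  assumes "(a :: 'k::field) \<noteq> 0"
  shows "bij_betw ((*) a) (- {0}) (- {0})"
  using assms by (intro bij_betw_byWitness[where f' = "\<lambda>t. t / a"]) auto

lemma power_card_UNIV_eq_1:
  assumes "(a :: 'k::{field,finite}) \<noteq> 0" "card (UNIV :: 'k set) = Suc m"
  shows "a ^ m = 1"
proof -
  have "\<Prod>(- {0::'k}) = (\<Prod>t\<in>- {0}. a * t)"
    using prod.reindex_bij_betw[OF bij_betw_mult_nonzero[OF assms(1)], of "\<lambda>t. t"] by simp
  also have "\<dots> = a ^ m * \<Prod>(- {0})"
    using assms(2) by (simp add: prod.distrib Compl_eq_Diff_UNIV)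
  finally show ?thesis by simp
qed

text \<open>For \<open>r > 0\<close> some \<open>g \<noteq> 0\<close> has
  \<open>g ^ r \<noteq> 1\<close>, since \<open>t ^ r - 1\<close> has at most \<open>r\<close>
  roots; substituting \<open>g * t\<close> for \<open>t\<close> multiplies the sum by
  \<open>g ^ r\<close>. For \<open>r = 0\<close> the sum is the cardinality of the field, which is 0
  in the field.\<close>

lemma sum_power_UNIV_eq_0:
  assumes "Suc r < card (UNIV :: 'k::{field,finite} set)"
  shows "(\<Sum>t\<in>(UNIV :: 'k set). t ^ r) = 0"
proof (cases "r = 0")
  case True
  thus ?thesis by (simp add: of_nat_card_UNIV_eq_0)
next
  case False
  define p :: "'k poly" where "p = monom 1 r - 1"
  have deg: "degree p \<le> r" by (simp add: p_def degree_diff_le degree_monom_le)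
  have "coeff p r = 1" using False by (simp add: p_def)
  hence p0: "p \<noteq> 0" by auto
  have "card {t. poly p t = 0} < card (- {0 :: 'k})"
    using card_poly_roots_bound[OF p0] deg assms by (simp add: Compl_eq_Diff_UNIV)
  hence "\<not> - {0} \<subseteq> {t. poly p t = 0}"
    using card_mono[of "{t. poly p t = 0}" "- {0}"] by auto
  then obtain g :: 'k where g: "g \<noteq> 0" "g ^ r \<noteq> 1"
    by (auto simp: p_def poly_monom)
  have "(\<Sum>t\<in>- {0::'k}. t ^ r) = (\<Sum>t\<in>- {0}. (g * t) ^ r)"
    using sum.reindex_bij_betw[OF bij_betw_mult_nonzero[OF g(1)], of "\<lambda>t. t ^ r"] by simp
  also have "\<dots> = g ^ r * (\<Sum>t\<in>- {0}. t ^ r)"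
    by (simp add: power_mult_distrib sum_distrib_left)
  finally have "(\<Sum>t\<in>- {0::'k}. t ^ r) = 0"
    using g(2) by simp
  moreover have "(\<Sum>t\<in>UNIV. t ^ r) = (0::'k) ^ r + (\<Sum>t\<in>- {0}. t ^ r)"
    by (simp add: sum.remove[of UNIV 0] Compl_eq_Diff_UNIV)
  ultimately show ?thesis using False by simp
qed

lemma sum_power_card_UNIV:
  assumes "card (UNIV :: 'k::{field,finite} set) = Suc m"
  shows "(\<Sum>t\<in>(UNIV :: 'k set). t ^ m) = - 1"
proof -
  \<comment> \<open>The field has at least two elements, so \<open>m > 0\<close> and the term for
    \<open>t = 0\<close> vanishes.\<close>
  have "card {0, 1 :: 'k} \<le> card (UNIV :: 'k set)" by (rule card_mono) auto
  hence m: "m \<noteq> 0" using assms by auto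
  have "(\<Sum>t\<in>(UNIV :: 'k set). t ^ m) = (\<Sum>t\<in>- {0::'k}. 1)"
    using m power_card_UNIV_eq_1[OF _ assms]
    by (intro sum.mono_neutral_cong_right) auto
  also have "\<dots> = of_nat m"
    using assms by (simp add: Compl_eq_Diff_UNIV)
  also have "\<dots> = - 1"
    using of_nat_card_UNIV_eq_0[where 'k = 'k] assms by (simp add: eq_neg_iff_add_eq_0 add.commute)
  finally show ?thesis .
qed

section \<open>Products of affine polynomials and their sums over the field\<close>

lemma degree_coeff_prod_linear:
  fixes a b :: "'i \<Rightarrow> 'a::comm_ring_1"
  assumes "finite I"
  shows "degree (\<Prod>i\<in>I. [:b i, a i:]) \<le> card I \<and>
    coeff (\<Prod>i\<in>I. [:b i, a i:]) (card I) = (\<Prod>i\<in>I. a i)"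
  using assms
proof (induction I rule: finite_induct)
  case (insert i I)
  let ?p = "\<Prod>i\<in>I. [:b i, a i:]"
  have eq: "(\<Prod>i\<in>insert i I. [:b i, a i:]) = smult (b i) ?p + pCons 0 (smult (a i) ?p)"
    using insert.hyps by simp
  have deg: "degree ?p \<le> card I" using insert.IH by simp
  \<comment> \<open>By the degree bound, \<open>smult (b i) ?p\<close> adds nothing to the new top
    coefficient; hence the two claims share one induction.\<close>
  hence z: "coeff ?p (Suc (card I)) = 0" by (intro coeff_eq_0) simp
  have "degree (smult (b i) ?p) \<le> Suc (card I)"
    using degree_smult_le[of "b i" ?p] deg by linarith
  moreover have "degree (pCons 0 (smult (a i) ?p)) \<le> Suc (card I)"
    using degree_pCons_le[of 0 "smult (a i) ?p"] degree_smult_le[of "a i" ?p] deg by linarith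
  ultimately show ?case
    unfolding eq using insert z by (auto intro: degree_add_le)
qed simp

lemma sum_prod_linear_UNIV:
  fixes a b :: "'i \<Rightarrow> 'k::{field,finite}"
  assumes "finite I" "card (UNIV :: 'k set) = Suc (card I)"
  shows "(\<Sum>t\<in>UNIV. \<Prod>i\<in>I. a i * t + b i) = - (\<Prod>i\<in>I. a i)"
proof -
  define p where "p = (\<Prod>i\<in>I. [:b i, a i:])"
  have p: "degree p \<le> card I" "coeff p (card I) = (\<Prod>i\<in>I. a i)"
    using degree_coeff_prod_linear[OF assms(1), of b a] by (simp_all add: p_def)
  have "(\<Prod>i\<in>I. a i * t + b i) = (\<Sum>r\<le>card I. coeff p r * t ^ r)" for t
  proof -
    have "(\<Prod>i\<in>I. a i * t + b i) = poly p t"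
      by (simp add: p_def poly_prod algebra_simps)
    also have "\<dots> = (\<Sum>r\<le>card I. coeff p r * t ^ r)"
      unfolding poly_altdef using p(1)
      by (intro sum.mono_neutral_left) (auto simp: coeff_eq_0)
    finally show ?thesis .
  qed
  hence "(\<Sum>t\<in>UNIV. \<Prod>i\<in>I. a i * t + b i) = (\<Sum>r\<le>card I. coeff p r * (\<Sum>t\<in>UNIV. t ^ r))"
    by (simp add: sum.swap[of _ UNIV] sum_distrib_left)
  also have "\<dots> = (\<Sum>r\<in>{card I}. coeff p r * (\<Sum>t\<in>UNIV. t ^ r))"
    using assms(2) by (intro sum.mono_neutral_right) (auto simp: sum_power_UNIV_eq_0)
  also have "\<dots> = - (\<Prod>i\<in>I. a i)"
    using p(2) sum_power_card_UNIV[OF assms(2)] by simp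
  finally show ?thesis .
qed

lemma sum_prod_linear_forms_update:
  fixes a :: "'i \<Rightarrow> 'j \<Rightarrow> 'k::{field,finite}"
  assumes "finite I" "card (UNIV :: 'k set) = Suc (card I)" "finite J" "j \<in> J"
  shows "(\<Sum>t\<in>UNIV. \<Prod>i\<in>I. \<Sum>l\<in>J. a i l * (x(j := t)) l) = - (\<Prod>i\<in>I. a i j)"
proof -
  have "(\<Sum>l\<in>J. a i l * (x(j := t)) l) = a i j * t + (\<Sum>l\<in>J - {j}. a i l * x l)" for i t
    using assms(3,4) by (simp add: sum.remove[of J j])
  thus ?thesis by (simp add: sum_prod_linear_UNIV[OF assms(1,2)])
qed

section \<open>The product of the row forms as a function of the zero set\<close>

lemma prod_linear_forms_eq_sum_zeros:
  fixes a :: "'i \<Rightarrow> 'j \<Rightarrow> 'k::{field,finite}"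
  assumes I: "finite I" "card (UNIV :: 'k set) = Suc (card I)" and J: "finite J"
    and van: "\<And>x. (\<forall>j\<in>J. x j \<noteq> 0) \<Longrightarrow> (\<Prod>i\<in>I. \<Sum>j\<in>J. a i j * x j) = 0"
  shows "(\<Prod>i\<in>I. \<Sum>j\<in>J. a i j * x j) = - (\<Sum>j\<in>{j\<in>J. x j = 0}. \<Prod>i\<in>I. a i j)"
proof (induction "card {j\<in>J. x j = 0}" arbitrary: x)
  case 0
  hence "{j\<in>J. x j = 0} = {}" using J by simp
  thus ?case using van[of x] by (simp only: sum.empty) auto
next
  case (Suc m)
  define F where "F x = (\<Prod>i\<in>I. \<Sum>j\<in>J. a i j * x j)" for x
  define c where "c j = (\<Prod>i\<in>I. a i j)" for j
  define Z where "Z = {j\<in>J. x j = 0}"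
  have Z: "card Z = Suc m" "finite Z" using Suc.hyps J by (simp_all add: Z_def)
  then obtain j where j: "j \<in> Z" by fastforce
  \<comment> \<open>Every nonzero value in coordinate \<open>j\<close> leaves one zero fewer, so the
    induction hypothesis gives the same value for all of them.\<close>
  have upd: "F (x(j := t)) = - (\<Sum>l\<in>Z - {j}. c l)" if "t \<noteq> 0" for t
  proof -
    have eq: "{l\<in>J. (x(j := t)) l = 0} = Z - {j}" using that by (auto simp: Z_def)
    show ?thesis
      using Suc.hyps(1)[of "x(j := t)"] Z j unfolding F_def c_def eq by simp
  qed
  have "x(j := 0) = x" using j by (auto simp: Z_def)
  hence "(\<Sum>t\<in>UNIV. F (x(j := t))) = F x + (\<Sum>t\<in>UNIV - {0::'k}. - (\<Sum>l\<in>Z - {j}. c l))"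
    by (simp add: sum.remove[of UNIV 0] upd)
  also have "\<dots> = F x + (\<Sum>l\<in>Z - {j}. c l)"
  proof -
    \<comment> \<open>Repeating a constant once for each nonzero \<open>t\<close> therefore flips
      its sign.\<close>
    have "of_nat (card (UNIV - {0::'k})) = (- 1 :: 'k)"
      using of_nat_card_UNIV_eq_0[where 'k = 'k] I(2)
      by (simp add: eq_neg_iff_add_eq_0 add.commute)
    thus ?thesis by (simp del: card_Diff_insert)
  qed
  finally have "F x = - c j - (\<Sum>l\<in>Z - {j}. c l)"
    using sum_prod_linear_forms_update[OF I J, of j a x] j
    by (simp add: F_def c_def Z_def algebra_simps eq_neg_iff_add_eq_0)
  also have "\<dots> = - (\<Sum>l\<in>Z. c l)" using Z j by (simp add: sum.remove[of Z j])
  finally show ?case by (simp add: F_def c_def Z_def)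
qed

lemma prod_linear_forms_eq_sum_support:
  fixes a :: "'i \<Rightarrow> 'j \<Rightarrow> 'k::{field,finite}"
  assumes I: "finite I" "card (UNIV :: 'k set) = Suc (card I)" "I \<noteq> {}" and J: "finite J"
    and van: "\<And>x. (\<forall>j\<in>J. x j \<noteq> 0) \<Longrightarrow> (\<Prod>i\<in>I. \<Sum>j\<in>J. a i j * x j) = 0"
  shows "(\<Prod>i\<in>I. \<Sum>j\<in>J. a i j * x j) = (\<Sum>j\<in>{j\<in>J. x j \<noteq> 0}. \<Prod>i\<in>I. a i j)"
proof -
  note eq = prod_linear_forms_eq_sum_zeros[OF I(1,2) J van]
  \<comment> \<open>At the zero vector every form vanishes, and \<open>I\<close> is nonempty. Since
    all column products thus sum to 0, passing from the zeros to the support flips the sign.\<close>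
  have "(\<Sum>j\<in>J. \<Prod>i\<in>I. a i j) = 0"
    using eq[of "\<lambda>_. 0"] I(1,3) by (simp add: power_0_left card_gt_0_iff)
  moreover have "(\<Sum>j\<in>J. \<Prod>i\<in>I. a i j) =
      (\<Sum>j\<in>{j\<in>J. x j = 0}. \<Prod>i\<in>I. a i j) + (\<Sum>j\<in>{j\<in>J. x j \<noteq> 0}. \<Prod>i\<in>I. a i j)"
    using J by (subst sum.union_disjoint[symmetric]) (auto intro: sum.cong)
  ultimately show ?thesis using eq[of x] by (simp add: add_eq_0_iff)
qed

section \<open>Vectors avoiding a family of hyperplanes\<close>

lemma exists_nonzero_of_linear_forms:
  fixes a :: "'i \<Rightarrow> 'j \<Rightarrow> 'k::{field,finite}"
  assumes "finite I" "card I < card (UNIV :: 'k set)" "finite J"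
    and "\<And>i. i \<in> I \<Longrightarrow> \<exists>j\<in>J. a i j \<noteq> 0"
  shows "\<exists>x. \<forall>i\<in>I. (\<Sum>j\<in>J. a i j * x j) \<noteq> 0"
  using assms(1,2,4)
proof (induction I rule: finite_induct)
  case (insert m I)
  define L where "L i x = (\<Sum>j\<in>J. a i j * x j)" for i and x :: "'j \<Rightarrow> 'k"
  obtain x where x: "\<forall>i\<in>I. L i x \<noteq> 0"
    using insert by (auto simp: L_def)
  obtain j where j: "j \<in> J" "a m j \<noteq> 0" using insert.prems by blast
  define y :: "'j \<Rightarrow> 'k" where "y l = (if l = j then 1 else 0)" for l
  have y: "L m y \<noteq> 0" using j assms(3) by (simp add: L_def y_def if_distrib cong: if_cong)
  show ?case
  proof (cases "L m x = 0")
    case False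
    thus ?thesis using x by (auto simp: L_def)
  next
    case True
    \<comment> \<open>On the line \<open>y + t * x\<close>, form \<open>m\<close> keeps its nonzero
      value at \<open>y\<close>, and each old form \<open>i\<close> vanishes for exactly one
      \<open>t\<close>; these exclude fewer than |k| values.\<close>
    have "card ((\<lambda>i. - L i y / L i x) ` I) < card (UNIV :: 'k set)"
      using card_image_le[OF insert.hyps(1), of "\<lambda>i. - L i y / L i x"] insert by simp
    hence "(\<lambda>i. - L i y / L i x) ` I \<noteq> UNIV" by (metis less_irrefl)
    then obtain t where t: "t \<notin> (\<lambda>i. - L i y / L i x) ` I" by blast
    have lin: "L i (\<lambda>l. y l + t * x l) = L i y + t * L i x" for i
      by (simp add: L_def sum.distrib sum_distrib_left algebra_simps)
    have "L i (\<lambda>l. y l + t * x l) \<noteq> 0" if "i \<in> insert m I" for i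
    proof (cases "i = m")
      case True
      thus ?thesis using lin y \<open>L m x = 0\<close> by simp
    next
      case False
      hence "i \<in> I" using that by simp
      hence "t \<noteq> - L i y / L i x" "L i x \<noteq> 0" using t x by auto
      thus ?thesis unfolding lin by (simp add: field_simps add_eq_0_iff)
    qed
    thus ?thesis unfolding L_def by (intro exI ballI)
  qed
qed simp

section \<open>Exactly two columns are nonzero\<close>

lemma nonvanishing_column_support:
  fixes a :: "'i \<Rightarrow> 'j \<Rightarrow> 'k::{field,finite}"
  assumes I: "finite I" "card (UNIV :: 'k set) = Suc (card I)" "I \<noteq> {}" and J: "finite J"
    and two: "(2::'k) \<noteq> 0"
    and rows: "\<And>i. i \<in> I \<Longrightarrow> \<exists>j\<in>J. a i j \<noteq> 0"
    and van: "\<And>x. (\<forall>j\<in>J. x j \<noteq> 0) \<Longrightarrow> (\<Prod>i\<in>I. \<Sum>j\<in>J. a i j * x j) = 0"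
  obtains j l where "j \<in> J" "l \<in> J" "j \<noteq> l" "\<And>i. i \<in> I \<Longrightarrow> a i j \<noteq> 0 \<and> a i l \<noteq> 0"
    "\<And>i m. i \<in> I \<Longrightarrow> m \<in> J \<Longrightarrow> m \<noteq> j \<Longrightarrow> m \<noteq> l \<Longrightarrow> a i m = 0"
proof -
  define F where "F x = (\<Prod>i\<in>I. \<Sum>j\<in>J. a i j * x j)" for x
  define c where "c j = (\<Prod>i\<in>I. a i j)" for j
  define S where "S = {j\<in>J. c j \<noteq> 0}"
  have F: "F x = (\<Sum>j\<in>{j\<in>J. x j \<noteq> 0}. c j)" for x
    unfolding F_def c_def by (rule prod_linear_forms_eq_sum_support[OF I J van])
  have full: "a i j \<noteq> 0" if "i \<in> I" "j \<in> S" for i j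
    using that I(1) by (auto simp: S_def c_def)
  obtain z where z: "F z \<noteq> 0"
    using exists_nonzero_of_linear_forms[where a = a, OF I(1) _ J rows] I(1,2)
    by (auto simp: F_def)
  have zero: "a i m = 0" if "i \<in> I" "m \<in> J" "m \<notin> S" for i m
  proof (rule ccontr)
    assume nz: "a i m \<noteq> 0"
    have cm: "c m = 0" using that by (simp add: S_def)
    \<comment> \<open>Changing coordinate \<open>m\<close> of \<open>z\<close> to \<open>t\<close>
      makes form \<open>i\<close> vanish.\<close>
    define t where "t = - (\<Sum>l\<in>J - {m}. a i l * z l) / a i m"
    have "(\<Sum>l\<in>J. a i l * (z(m := t)) l) = 0"
      using that J nz by (simp add: sum.remove[of J m] t_def)
    hence "F (z(m := t)) = 0" using that(1) I(1) by (auto simp: F_def)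
    moreover have "F (z(m := t)) = F z"
    proof -
      have "F x = (\<Sum>j\<in>{j\<in>J - {m}. x j \<noteq> 0}. c j)" for x
        unfolding F using J cm by (intro sum.mono_neutral_right) auto
      moreover have "{j\<in>J - {m}. (z(m := t)) j \<noteq> 0} = {j\<in>J - {m}. z j \<noteq> 0}" by auto
      ultimately show ?thesis by simp
    qed
    ultimately show False using z by simp
  qed
  have pair: "c j + c l = 0" if "j \<in> S" "l \<in> S" "j \<noteq> l" for j l
  proof -
    obtain i where i: "i \<in> I" using I(3) by auto
    have nz: "a i j \<noteq> 0" "a i l \<noteq> 0" using full i that by auto
    have jl: "j \<in> J" "l \<in> J" using that by (auto simp: S_def)
    \<comment> \<open>Supported on \<open>{j, l}\<close>, and chosen so that the two terms of form
      \<open>i\<close> cancel.\<close>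
    define x where "x m = (if m = j then a i l else if m = l then - a i j else 0)" for m
    have "(\<Sum>m\<in>J. a i m * x m) = (\<Sum>m\<in>{j, l}. a i m * x m)"
      using J jl by (intro sum.mono_neutral_right) (auto simp: x_def)
    also have "\<dots> = 0" using that by (simp add: x_def)
    finally have "F x = 0" using i I(1) by (auto simp: F_def)
    moreover have "{m\<in>J. x m \<noteq> 0} = {j, l}" using nz jl by (auto simp: x_def)
    ultimately show ?thesis using F[of x] that by simp
  qed
  have finS: "finite S" using J by (simp add: S_def)
  have sumS: "(\<Sum>j\<in>S. c j) = 0"
  proof -
    \<comment> \<open>The all-ones vector has full support, and \<open>F\<close> vanishes
      there.\<close>
    have "(\<Sum>j\<in>J. c j) = 0" using F[of "\<lambda>_. 1"] van[of "\<lambda>_. 1"] by (simp add: F_def)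
    moreover have "(\<Sum>j\<in>S. c j) = (\<Sum>j\<in>J. c j)"
      using J by (intro sum.mono_neutral_left) (auto simp: S_def)
    ultimately show ?thesis by simp
  qed
  obtain j where j: "j \<in> S"
  proof -
    obtain i where "i \<in> I" using I(3) by auto
    with rows zero show ?thesis using that by blast
  qed
  \<comment> \<open>Otherwise \<open>c j\<close> would be the whole sum, hence 0.\<close>
  have "S \<noteq> {j}" using sumS j by (auto simp: S_def)
  then obtain l where l: "l \<in> S" "j \<noteq> l" using j by blast
  have only: "m = j \<or> m = l" if "m \<in> S" for m
  proof (rule ccontr)
    assume "\<not> ?thesis"
    hence "c j + c l = 0" "c j + c m = 0" "c l + c m = 0"
      using pair j l that by auto
    \<comment> \<open>A third column lets the pairwise relations isolate
      \<open>2 * c j\<close>.\<close>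
    moreover have "2 * c j = (c j + c l) + (c j + c m) - (c l + c m)" by simp
    ultimately have "2 * c j = 0" by simp
    thus False using two j by (simp add: S_def)
  qed
  show ?thesis
  proof (rule that)
    show "j \<in> J" "l \<in> J" using j l by (auto simp: S_def)
    show "a i j \<noteq> 0 \<and> a i l \<noteq> 0" if "i \<in> I" for i
      using full that j l by simp
    show "a i m = 0" if "i \<in> I" "m \<in> J" "m \<noteq> j" "m \<noteq> l" for i m
      using zero that only by metis
  qed (fact l)
qed

section \<open>Identifying the matrix\<close>

lemma permutes_two_points:
  assumes "j \<in> S" "l \<in> S" "u \<in> S" "v \<in> S" "j \<noteq> l" "u \<noteq> v"
  obtains \<sigma> where "\<sigma> permutes S" "\<sigma> j = u" "\<sigma> l = v"
proof -
  define \<tau> where "\<tau> = transpose j u"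
  \<comment> \<open>Ensures that the second swap, of \<open>\<tau> l\<close> and \<open>v\<close>,
    leaves \<open>u = \<tau> j\<close> in place.\<close>
  have "\<tau> l \<noteq> u" using assms by (auto simp: \<tau>_def transpose_def)
  moreover have "\<tau> l \<in> S" using assms by (auto simp: \<tau>_def transpose_def)
  ultimately show ?thesis using assms
    by (intro that[of "transpose (\<tau> l) v \<circ> \<tau>"])
       (auto simp: \<tau>_def intro!: permutes_compose permutes_swap_id)
qed

theorem proposition26:
  fixes A :: "'k::{field,finite} mat" and d n :: nat
  assumes "prime (d + 1)"
    and "d \<ge> 2"
    and "card (UNIV :: 'k set) = d + 1"
    and "A \<in> carrier_mat d n"
    and "\<not> (\<exists>X \<in> carrier_vec n. nowhere_zero_vec X \<and> nowhere_zero_vec (A *\<^sub>v X))"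
  shows "(\<exists>i < d. row A i = 0\<^sub>v n) \<or>
    (n \<ge> 2 \<and> (\<exists>b :: nat \<Rightarrow> 'k. b ` {..<d} = UNIV - {0} \<and>
       eq_upto_row_scaling_col_perm A (one_b_mat d n b)))"
proof (rule disjCI[THEN disj_commute[THEN iffD1]])
  assume nz: "\<not> (\<exists>i < d. row A i = 0\<^sub>v n)"
  define a where "a i j = A $$ (i, j)" for i j
  have rows: "\<exists>j\<in>{..<n}. a i j \<noteq> 0" if "i \<in> {..<d}" for i
  proof (rule ccontr)
    assume "\<not> ?thesis"
    hence "row A i = 0\<^sub>v n" using assms(4) that by (auto simp: a_def)
    thus False using nz that by auto
  qed
  have ex: "\<exists>i<d. (\<Sum>j<n. a i j * x j) = 0" if "\<forall>j<n. x j \<noteq> 0" for x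
  proof -
    have "nowhere_zero_vec (vec n x)" using that by (simp add: nowhere_zero_vec_def)
    hence "\<not> nowhere_zero_vec (A *\<^sub>v vec n x)" using assms(5) by auto
    then obtain i where i: "i < d" "(A *\<^sub>v vec n x) $ i = 0"
      using assms(4) by (auto simp: nowhere_zero_vec_def)
    have "(A *\<^sub>v vec n x) $ i = (\<Sum>j<n. a i j * x j)"
      using i(1) assms(4) by (auto simp: scalar_prod_def a_def atLeast0LessThan intro!: sum.cong)
    thus ?thesis using i by auto
  qed
  hence van: "(\<Prod>i\<in>{..<d}. \<Sum>j<n. a i j * x j) = 0" if "\<forall>j\<in>{..<n}. x j \<noteq> 0" for x
    using that by auto
  \<comment> \<open>As \<open>d + 1\<close> is an odd prime, |k| = 2m + 1 vanishes in the field;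
    with 2 = 0 this would give 1 = 0.\<close>
  have "even d" using prime_odd_nat[OF assms(1)] assms(2) by auto
  then obtain m where m: "d = 2 * m" by (elim evenE)
  have two: "(2::'k) \<noteq> 0"
  proof
    assume "(2::'k) = 0"
    moreover have "(1::'k) + 2 * of_nat m = 0"
      using of_nat_card_UNIV_eq_0[where 'k = 'k] assms(3) m by simp
    ultimately show False by simp
  qed
  have d: "card (UNIV :: 'k set) = Suc (card {..<d})" "{..<d} \<noteq> {}"
    using assms(2,3) by (auto simp: lessThan_empty_iff)
  obtain j l where jl: "j \<in> {..<n}" "l \<in> {..<n}" "j \<noteq> l"
    and full: "\<And>i. i \<in> {..<d} \<Longrightarrow> a i j \<noteq> 0 \<and> a i l \<noteq> 0"
    and zero: "\<And>i m. i \<in> {..<d} \<Longrightarrow> m \<in> {..<n} \<Longrightarrow> m \<noteq> j \<Longrightarrow> m \<noteq> l \<Longrightarrow> a i m = 0"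
    by (rule nonvanishing_column_support[where a = a, OF finite_lessThan d finite_lessThan two rows van])
       (assumption | rule that)+
  have n: "n \<ge> 2" using jl by auto
  \<comment> \<open>Dividing row \<open>i\<close> by its entry in column \<open>j\<close> leaves 1
    there and \<open>b i\<close> in column \<open>l\<close>.\<close>
  define b where "b i = a i l / a i j" for i
  have "b ` {..<d} = UNIV - {0}"
  proof (intro equalityI subsetI)
    fix y assume y: "y \<in> UNIV - {0::'k}"
    \<comment> \<open>No entry of \<open>x\<close> is zero, so some row annihilates it; that row
      reads \<open>a i j * y - a i l = 0\<close>, which makes \<open>y\<close> a value of
      \<open>b\<close>.\<close>
    define x where "x m = (if m = j then y else if m = l then - 1 else 1)" for m
    have "\<forall>m<n. x m \<noteq> 0" using y by (simp add: x_def)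
    then obtain i where i: "i < d" "(\<Sum>m<n. a i m * x m) = 0" using ex by blast
    have "(\<Sum>m<n. a i m * x m) = (\<Sum>m\<in>{j, l}. a i m * x m)"
      using jl zero i(1) by (intro sum.mono_neutral_right) auto
    hence "a i j * y = a i l" using jl(3) i(2) by (simp add: x_def)
    hence "y = b i" using full[of i] i(1) by (simp add: b_def field_simps)
    thus "y \<in> b ` {..<d}" using i(1) by auto
  qed (use full in \<open>auto simp: b_def\<close>)
  moreover have "eq_upto_row_scaling_col_perm A (one_b_mat d n b)"
  proof -
    obtain \<sigma> where \<sigma>: "\<sigma> permutes {..<n}" "\<sigma> j = 0" "\<sigma> l = 1"
      using permutes_two_points[OF jl(1,2) _ _ jl(3), of 0 1] n by auto
    have ran: "\<sigma> m < n" if "m < n" for m using permutes_in_image[OF \<sigma>(1)] that by auto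
    have inj: "\<sigma> m = 0 \<longleftrightarrow> m = j" "\<sigma> m = Suc 0 \<longleftrightarrow> m = l" for m
      using inj_eq[OF permutes_inj[OF \<sigma>(1)], of m j]
        inj_eq[OF permutes_inj[OF \<sigma>(1)], of m l] \<sigma>(2,3) by simp_all
    \<comment> \<open>Row \<open>i\<close> is scaled by \<open>a i j\<close>;
      \<open>\<sigma>\<close> sends the two nonzero columns to 0 and 1, and all others to zero
      columns of \<open>one_b_mat\<close>.\<close>
    have "A = mat d n (\<lambda>(i, m). a i j * one_b_mat d n b $$ (i, \<sigma> m))"
    proof (rule eq_matI)
      fix i m assume "i < dim_row (mat d n (\<lambda>(i, m). a i j * one_b_mat d n b $$ (i, \<sigma> m)))"
        "m < dim_col (mat d n (\<lambda>(i, m). a i j * one_b_mat d n b $$ (i, \<sigma> m)))"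
      hence im: "i < d" "m < n" by auto
      show "A $$ (i, m) = mat d n (\<lambda>(i, m). a i j * one_b_mat d n b $$ (i, \<sigma> m)) $$ (i, m)"
        using im ran[OF im(2)] full[of i] zero[of i m]
        by (auto simp: one_b_mat_def inj b_def a_def)
    qed (use assms(4) in auto)
    thus ?thesis unfolding eq_upto_row_scaling_col_perm_def using \<sigma>(1) full
      by (intro exI[of _ "\<lambda>i. a i j"] exI[of _ \<sigma>]) (auto simp: one_b_mat_def)
  qed
  ultimately show "n \<ge> 2 \<and> (\<exists>b :: nat \<Rightarrow> 'k. b ` {..<d} = UNIV - {0} \<and>
       eq_upto_row_scaling_col_perm A (one_b_mat d n b))"
    using n by blast
qed

end
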